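(* Let $n\ge 2$, let $G$ be a connected bipartite simple graph with $n$ vertices, and let $\alpha\le 1$ be a non-zero real number. Then: (1) If $\alpha<0$, then $$S_{\alpha}(G)\geq n^\alpha+\left(\left\lfloor\tfrac{n}{2}\right\rfloor-1\right)\left\lceil\tfrac{n}{2}\right\rceil^\alpha+\left(\left\lceil\tfrac{n}{2}\right\rceil-1\right)\left\lfloor\tfrac{n}{2}\right\rfloor^\alpha,$$ with equality if and only if $G=K_{\lfloor n/2\rfloor,\lceil n/2\rceil}$. (2) If $0<\alpha\leq 1$, then $$S_{\alpha}(G)\leq n^\alpha+\left(\left\lfloor\tfrac{n}{2}\right\rfloor-1\right)\left\lceil\tfrac{n}{2}\right\rceil^\alpha+\left(\left\lceil\tfrac{n}{2}\right\rceil-1\right)\left\lfloor\tfrac{n}{2}\right\rfloor^\alpha,$$ with equality if and only if $G=K_{\lfloor n/2\rfloor,\lceil n/2\rceil}$.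
   Context: For a simple graph $G$ on $n$ vertices with adjacency matrix $A(G)$ and diagonal degree matrix $D(G)$, the signless Laplacian matrix is $Q(G)=D(G)+A(G)$; it is symmetric positive semidefinite with eigenvalues $q_1(G)\ge\cdots\ge q_n(G)\ge 0$. For a non-zero real $\alpha$, $S_\alpha(G)=\sum_{i=1}^{h} q_i(G)^\alpha$, where $h$ is the number of non-zero eigenvalues of $Q(G)$ (counted with multiplicity). $K_{r,s}$ is the complete bipartite graph with parts of sizes $r$ and $s$. Equality of graphs means isomorphism. *)

theory Defs
  imports
    "HOL-Computational_Algebra.Polynomial"
    "Jordan_Normal_Form.Char_Poly"
    "Graph_Theory.Graph_Theory"
begin

text \<open>
  Simple graphs are the finite, loop-free, symmetric digraphs without parallel arcs of
  the locale \<^locale>\<open>graph\<close>: an undirected edge is a pair of opposite arcs, so the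
  degree of a vertex is its \<^const>\<open>out_degree\<close>.
  A list \<open>vs\<close> enumerating the vertices without repetition fixes the order of the rows and
  columns of the matrices.
\<close>

definition bipartite :: "('a, 'b) pre_digraph \<Rightarrow> bool" where
  "bipartite G \<longleftrightarrow> (\<exists>U V. verts G = U \<union> V \<and> U \<inter> V = {} \<and> arcs_ends G \<subseteq> U \<times> V \<union> V \<times> U)"

definition adjacency_matrix :: "('a, 'b) pre_digraph \<Rightarrow> 'a list \<Rightarrow> real mat" where
  "adjacency_matrix G vs =
     mat (length vs) (length vs) (\<lambda>(i, j). if vs ! i \<rightarrow>\<^bsub>G\<^esub> vs ! j then 1 else 0)"

definition degree_matrix :: "('a, 'b) pre_digraph \<Rightarrow> 'a list \<Rightarrow> real mat" where
  "degree_matrix G vs =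
     mat (length vs) (length vs) (\<lambda>(i, j). if i = j then real (out_degree G (vs ! i)) else 0)"

definition signless_laplacian :: "('a, 'b) pre_digraph \<Rightarrow> 'a list \<Rightarrow> real mat" where
  "signless_laplacian G vs = degree_matrix G vs + adjacency_matrix G vs"

text \<open>
  For a real symmetric matrix every complex root of the characteristic polynomial is real, so
  this multiset contains all the eigenvalues with their multiplicities.
\<close>

definition eigenvalues_mset :: "real mat \<Rightarrow> real multiset" where
  "eigenvalues_mset A = proots (char_poly A)"

definition S_alpha :: "real \<Rightarrow> ('a, 'b) pre_digraph \<Rightarrow> 'a list \<Rightarrow> real" where
  "S_alpha \<alpha> G vs =
     (\<Sum>q\<in>#filter_mset (\<lambda>q. q \<noteq> 0) (eigenvalues_mset (signless_laplacian G vs)). q powr \<alpha>)"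

end

theory Submission
  imports Defs "Jordan_Normal_Form.Spectral_Radius"
begin

text \<open>
  Let \<open>G\<close> be connected and bipartite with parts \<open>U\<close>, \<open>V\<close> of sizes \<open>r\<close>, \<open>s\<close> and with \<open>m\<close> edges,
  and put \<open>f x = sgn \<alpha> * x powr \<alpha>\<close>. For non-zero \<open>\<alpha> \<le> 1\<close> this function is concave and increasing on
  the positive reals, so that both parts of the theorem say that the sum of \<open>f\<close> over the non-zero
  eigenvalues is at most its value for the balanced complete bipartite graph.

  The comparison with \<open>K\<^bsub>r,s\<^esub>\<close> is an instance of Klein's trace inequality. The signless Laplacian
  of \<open>K\<^bsub>r,s\<^esub>\<close> has the eigenspaces: the signing vector (\<open>1\<close> on \<open>U\<close> and \<open>-1\<close> on \<open>V\<close>) for \<open>0\<close>; the vector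
  \<open>z\<close> (\<open>s\<close> on \<open>U\<close> and \<open>r\<close> on \<open>V\<close>) for \<open>r + s\<close>; the vectors of sum zero supported on \<open>U\<close> for \<open>s\<close>; those
  supported on \<open>V\<close> for \<open>r\<close>. Let \<open>u\<^sub>i\<close> be an orthonormal eigenbasis for \<open>G\<close> with eigenvalues \<open>a\<^sub>i\<close>. The
  squared norms of the projections of \<open>u\<^sub>i\<close> onto the last three spaces (\<open>top_weight\<close> and
  \<open>centered_norm_sq\<close> for either part) add up to \<open>1\<close> if \<open>a\<^sub>i \<noteq> 0\<close>. If \<open>a\<^sub>i = 0\<close> they all vanish, because
  connectedness makes the kernel of \<open>G\<close> the line of the signing vector. Hence one can bound
  \<open>f a\<^sub>i\<close> by the average, with these weights, of the tangent lines of \<open>f\<close> at \<open>r + s\<close>, \<open>s\<close> and \<open>r\<close>. Summing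
  over \<open>i\<close> produces only traces: the total weights \<open>1\<close>, \<open>r - 1\<close>, \<open>s - 1\<close>, and the \<open>a\<^sub>i\<close>-weighted totals,
  which are \<open>m\<close> times explicit constants because \<open>U\<close> and \<open>V\<close> span no edges. The outcome
  (\<open>spectral_sum_le\<close>) is the value for \<open>K\<^bsub>r,s\<^esub>\<close> minus \<open>r s - m\<close> times a positive constant, so
  equality forces \<open>m = r s\<close>. Conversely, in \<open>K\<^bsub>r,s\<^esub>\<close> a positive weight pins down the
  eigenvalue, so the same weighted sum is then exact (\<open>spectral_sum_complete\<close>).

  It remains to maximise the value for \<open>K\<^bsub>r,s\<^esub>\<close> over \<open>r + s = n\<close>. Up to a constant it is
  \<open>g r + g s\<close> with \<open>g x = sgn \<alpha> * (x - 1) * (n - x) powr \<alpha>\<close>, and \<open>g\<close> is strictly concave, so the balanced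
  choice wins strictly (\<open>bipartite_power_sum_le_balanced\<close>).

  The orthonormal eigenbasis comes from the spectral theorem for real symmetric matrices, proved
  by splitting off one eigenvector at a time.
\<close>

section \<open>The spectral theorem for real symmetric matrices\<close>

text \<open>
  A complex eigenvector \<open>x + \<i> y\<close> exists because the characteristic polynomial has a complex root. As
  that root turns out to be real, \<open>x\<close> and \<open>y\<close> separately satisfy the eigenvector equation, and one of
  them is non-zero.
\<close>

lemma real_symmetric_unit_eigenvector:
  fixes A :: "real mat"
  assumes A: "A \<in> carrier_mat n n" and sym: "A\<^sup>T = A" and n: "n > 0"
  obtains p v where "v \<in> carrier_vec n" "v \<bullet> v = 1" "A *\<^sub>v v = p \<cdot>\<^sub>v v"
proof -
  let ?C = "map_mat complex_of_real A"
  have C: "?C \<in> carrier_mat n n" using A by simp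
  from spectrum_non_empty[OF C n] obtain e z where "eigenvector ?C z e"
    by (auto simp: spectrum_def eigenvalue_def)
  then have z: "z \<in> carrier_vec n" "z \<noteq> 0\<^sub>v n" "?C *\<^sub>v z = e \<cdot>\<^sub>v z"
    using A by (auto simp: eigenvector_def)
  define x y where "x = map_vec Re z" and "y = map_vec Im z"
  have x: "x \<in> carrier_vec n" and y: "y \<in> carrier_vec n" using z by (auto simp: x_def y_def)
  have ent: "(\<Sum>j<n. complex_of_real (A $$ (i,j)) * z $ j) = e * z $ i" if "i < n" for i
    using arg_cong[OF z(3), of "\<lambda>w. w $ i"] that z(1) A
    by (simp add: scalar_prod_def lessThan_atLeast0)
  have Ax: "A *\<^sub>v x = Re e \<cdot>\<^sub>v x + (- Im e) \<cdot>\<^sub>v y"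
  proof (rule eq_vecI)
    fix i assume "i < dim_vec (Re e \<cdot>\<^sub>v x + (- Im e) \<cdot>\<^sub>v y)"
    then have i: "i < n" using y by simp
    show "(A *\<^sub>v x) $ i = (Re e \<cdot>\<^sub>v x + (- Im e) \<cdot>\<^sub>v y) $ i"
      using arg_cong[OF ent[OF i], of Re] i z(1) A
      by (simp add: scalar_prod_def lessThan_atLeast0 x_def y_def)
  qed (use A y in auto)
  have Ay: "A *\<^sub>v y = Im e \<cdot>\<^sub>v x + Re e \<cdot>\<^sub>v y"
  proof (rule eq_vecI)
    fix i assume "i < dim_vec (Im e \<cdot>\<^sub>v x + Re e \<cdot>\<^sub>v y)"
    then have i: "i < n" using y by simp
    show "(A *\<^sub>v y) $ i = (Im e \<cdot>\<^sub>v x + Re e \<cdot>\<^sub>v y) $ i"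
      using arg_cong[OF ent[OF i], of Im] i z(1) A
      by (simp add: scalar_prod_def lessThan_atLeast0 x_def y_def)
  qed (use A y in auto)
  \<comment> \<open>Symmetry gives \<open>A x \<bullet> y = x \<bullet> A y\<close>, which forces the imaginary part of \<open>e\<close> to vanish.\<close>
  have "(A *\<^sub>v x) \<bullet> y = x \<bullet> (A *\<^sub>v y)"
    using transpose_vec_mult_scalar[of A n n y x] A x y sym
    by (metis comm_scalar_prod mult_mat_vec_carrier)
  then have "- Im e * (y \<bullet> y) = Im e * (x \<bullet> x)"
    unfolding Ax Ay using x y
    by (simp add: add_scalar_prod_distrib[of _ n] scalar_prod_add_distrib[of _ n])
  then have "Im e * (x \<bullet> x + y \<bullet> y) = 0" by (simp add: algebra_simps)
  have nonneg: "w \<bullet> w \<ge> 0" for w :: "real vec" by (simp add: scalar_prod_def sum_nonneg)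
  have pos: "w \<bullet> w > 0" if "w \<in> carrier_vec n" "w \<noteq> 0\<^sub>v n" for w :: "real vec"
    using conjugate_square_greater_0_vec[of w n] that
    by (simp add: scalar_prod_def)
  have ne: "x \<noteq> 0\<^sub>v n \<or> y \<noteq> 0\<^sub>v n"
  proof (rule ccontr)
    assume "\<not> ?thesis"
    then have "x $ i = 0" "y $ i = 0" if "i < n" for i
      using that by auto
    then have "Re (z $ i) = 0" "Im (z $ i) = 0" if "i < n" for i
      using that z(1) by (auto simp: x_def y_def)
    then have "z = 0\<^sub>v n" using z(1) by (intro eq_vecI) (auto simp: complex_eq_iff)
    then show False using z by simp
  qed
  then have "x \<bullet> x + y \<bullet> y > 0"
    using pos x y nonneg by (metis add_pos_nonneg add_nonneg_pos)
  then have "Im e = 0" using \<open>Im e * _ = 0\<close> by simp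
  then have "A *\<^sub>v x = Re e \<cdot>\<^sub>v x" "A *\<^sub>v y = Re e \<cdot>\<^sub>v y"
    unfolding Ax Ay using x y by (auto intro!: eq_vecI)
  then obtain w where w: "w \<in> carrier_vec n" "w \<noteq> 0\<^sub>v n" "A *\<^sub>v w = Re e \<cdot>\<^sub>v w"
    using ne x y by blast
  define c where "c = 1 / sqrt (w \<bullet> w)"
  have "c * c * (w \<bullet> w) = 1" using pos[OF w(1,2)] by (simp add: c_def)
  show thesis
  proof (rule that[of "c \<cdot>\<^sub>v w" "Re e"])
    show "c \<cdot>\<^sub>v w \<in> carrier_vec n" using w by simp
    show "(c \<cdot>\<^sub>v w) \<bullet> (c \<cdot>\<^sub>v w) = 1" using w \<open>c * c * _ = 1\<close> by simp
    show "A *\<^sub>v (c \<cdot>\<^sub>v w) = Re e \<cdot>\<^sub>v (c \<cdot>\<^sub>v w)"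
      using w A by (simp add: mult_mat_vec smult_smult_assoc mult.commute)
  qed
qed

text \<open>
  The reflection \<open>1 - 2 w w\<^sup>T / (w \<bullet> w)\<close> in the hyperplane orthogonal to \<open>w = v - unit_vec n 0\<close> swaps the
  unit vectors \<open>v\<close> and \<open>unit_vec n 0\<close>. It is a symmetric orthogonal matrix with prescribed first
  column, which replaces the completion of \<open>v\<close> to an orthonormal basis.
\<close>

lemma householder_reflection:
  fixes v :: "real vec"
  assumes v: "v \<in> carrier_vec n" and unit: "v \<bullet> v = 1" and n: "n > 0"
  obtains H where "H \<in> carrier_mat n n" "H\<^sup>T = H" "H * H = 1\<^sub>m n" "H *\<^sub>v unit_vec n 0 = v"
proof (cases "v $ 0 = 1")
  case True
  have sq: "(\<Sum>i<n. (v $ i)\<^sup>2) = 1"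
    using unit v by (simp add: scalar_prod_def power2_eq_square lessThan_atLeast0)
  have "(\<Sum>i\<in>{..<n}-{0}. (v $ i)\<^sup>2) = 0"
    using sq True n by (simp add: sum.remove[of "{..<n}" 0])
  then have "v $ i = 0" if "i < n" "i \<noteq> 0" for i
    using that by (subst (asm) sum_nonneg_eq_0_iff) auto
  then have "v = unit_vec n 0" using v True by (intro eq_vecI) auto
  then show thesis using that[of "1\<^sub>m n"] by simp
next
  case False
  have sq: "(\<Sum>i<n. (v $ i)\<^sup>2) = 1"
    using unit v by (simp add: scalar_prod_def power2_eq_square lessThan_atLeast0)
  have "(v $ 0)\<^sup>2 \<le> 1" unfolding sq[symmetric] by (rule member_le_sum) (use n in auto)
  then have lt: "v $ 0 < 1" using False by (metis abs_le_square_iff abs_one abs_le_iff order_le_less one_power2)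
  define w where "w i = v $ i - (if i = 0 then 1 else 0)" for i
  \<comment> \<open>Here \<open>w \<bullet> w = 2 - 2 * v $ 0\<close>, so \<open>c\<close> is the factor \<open>2 / (w \<bullet> w)\<close> of the reflection.\<close>
  define c where "c = 1 / (1 - v $ 0)"
  have ww: "(\<Sum>i<n. w i * w i) * c = 2"
  proof -
    have "(\<Sum>i<n. w i * w i) = (\<Sum>i<n. (v $ i)\<^sup>2 + (if i = 0 then 1 - 2 * v $ 0 else 0))"
      by (rule sum.cong) (auto simp: w_def power2_eq_square algebra_simps)
    also have "\<dots> = 2 - 2 * v $ 0" using sq n by (simp add: sum.distrib)
    finally show ?thesis using lt by (simp add: c_def field_simps)
  qed
  define H where "H = mat n n (\<lambda>(i,j). (if i = j then 1 else 0) - c * w i * w j)"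
  show thesis
  proof (rule that[of H])
    show H: "H \<in> carrier_mat n n" by (simp add: H_def)
    show "H\<^sup>T = H" by (rule eq_matI) (auto simp: H_def)
    show "H * H = 1\<^sub>m n"
    proof (rule eq_matI)
      fix i j assume "i < dim_row (1\<^sub>m n :: real mat)" "j < dim_col (1\<^sub>m n :: real mat)"
      then have ij: "i < n" "j < n" by auto
      have "(H * H) $$ (i,j)
        = (\<Sum>k<n. ((if i = k then 1 else 0) - c * w i * w k) * ((if k = j then 1 else 0) - c * w k * w j))"
        using ij by (simp add: H_def scalar_prod_def lessThan_atLeast0)
      also have "\<dots> = (\<Sum>k<n. (if k = i then (if i = j then 1 else 0) - c * w i * w j else 0)
            - (if k = j then c * w i * w j else 0) + c * w i * w j * c * (w k * w k))"
        by (rule sum.cong) (auto simp: algebra_simps)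
      also have "\<dots> = (if i = j then 1 else 0) - 2 * c * w i * w j + c * w i * w j * ((\<Sum>k<n. w k * w k) * c)"
        using ij by (simp add: sum.distrib sum_subtractf sum_distrib_left sum_distrib_right algebra_simps)
      also have "\<dots> = (if i = j then 1 else 0)" unfolding ww by simp
      finally show "(H * H) $$ (i,j) = 1\<^sub>m n $$ (i,j)" using ij by simp
    qed (auto simp: H_def)
    have c0: "c * w 0 = - 1" using lt by (simp add: c_def w_def field_simps)
    show "H *\<^sub>v unit_vec n 0 = v"
    proof (rule eq_vecI)
      fix i assume "i < dim_vec v"
      then have i: "i < n" using v by simp
      have "(H *\<^sub>v unit_vec n 0) $ i = H $$ (i,0)" using i n H by simp
      also have "\<dots> = (if i = 0 then 1 else 0) - w i * (c * w 0)" using i n by (simp add: H_def)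
      also have "\<dots> = v $ i" unfolding c0 by (simp add: w_def)
      finally show "(H *\<^sub>v unit_vec n 0) $ i = v $ i" .
    qed (use v in \<open>auto simp: H_def\<close>)
  qed
qed

text \<open>
  Conjugating with the reflection that moves a unit eigenvector to the first basis vector makes the
  first column, and by symmetry the first row, vanish off the diagonal; the induction hypothesis
  applies to the remaining block.
\<close>

theorem real_symmetric_orthogonally_diagonalizable:
  fixes A :: "real mat"
  assumes "A \<in> carrier_mat n n" and "A\<^sup>T = A"
  shows "\<exists>P D. P \<in> carrier_mat n n \<and> D \<in> carrier_mat n n \<and> P\<^sup>T * P = 1\<^sub>m n \<and> diagonal_mat D
    \<and> A = P * D * P\<^sup>T"
  using assms
proof (induction n arbitrary: A)
  case 0
  then show ?case
    by (intro exI[of _ "1\<^sub>m 0"] exI[of _ A]) (auto simp: diagonal_mat_def intro!: eq_matI)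
next
  case (Suc m)
  note A = Suc.prems(1) and sym = Suc.prems(2)
  let ?n = "Suc m"
  obtain p v where v: "v \<in> carrier_vec ?n" "v \<bullet> v = 1" "A *\<^sub>v v = p \<cdot>\<^sub>v v"
    using real_symmetric_unit_eigenvector[OF A sym] by blast
  obtain H where H: "H \<in> carrier_mat ?n ?n" "H\<^sup>T = H" "H * H = 1\<^sub>m ?n" "H *\<^sub>v unit_vec ?n 0 = v"
    using householder_reflection[OF v(1,2)] by blast
  have Hv: "H *\<^sub>v v = unit_vec ?n 0"
    using H by (metis assoc_mult_mat_vec one_mult_mat_vec unit_vec_carrier)
  define B where "B = H * A * H"
  have B: "B \<in> carrier_mat ?n ?n" using A H by (simp add: B_def)
  have symB: "B\<^sup>T = B"
    unfolding B_def using A H sym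
    by (simp add: transpose_mult[of _ ?n ?n _ ?n] assoc_mult_mat[of _ ?n ?n _ ?n _ ?n])
  have "B *\<^sub>v unit_vec ?n 0 = H *\<^sub>v (A *\<^sub>v (H *\<^sub>v unit_vec ?n 0))"
    using A H by (simp add: B_def assoc_mult_mat_vec[of _ ?n ?n _ ?n])
  also have "\<dots> = p \<cdot>\<^sub>v unit_vec ?n 0"
    using H v Hv by (simp add: mult_mat_vec[of _ ?n ?n])
  finally have B0: "B *\<^sub>v unit_vec ?n 0 = p \<cdot>\<^sub>v unit_vec ?n 0" .
  have col0: "B $$ (i,0) = (if i = 0 then p else 0)" if "i < ?n" for i
    using arg_cong[OF B0, of "\<lambda>w. w $ i"] that B by auto
  have row0: "B $$ (0,i) = (if i = 0 then p else 0)" if "i < ?n" for i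
    using col0[OF that] arg_cong[OF symB, of "\<lambda>M. M $$ (0,i)"] that B by auto
  define B' where "B' = mat m m (\<lambda>(i,j). B $$ (Suc i, Suc j))"
  have B': "B' \<in> carrier_mat m m" by (simp add: B'_def)
  have "B'\<^sup>T = B'"
  proof (rule eq_matI)
    fix i j assume "i < dim_row B'" "j < dim_col B'"
    then show "B'\<^sup>T $$ (i,j) = B' $$ (i,j)"
      using arg_cong[OF symB, of "\<lambda>M. M $$ (Suc i, Suc j)"] B by (auto simp: B'_def)
  qed (use B' in auto)
  then obtain P' D' where P': "P' \<in> carrier_mat m m" and D': "D' \<in> carrier_mat m m"
    and orth: "P'\<^sup>T * P' = 1\<^sub>m m" and diag: "diagonal_mat D'" and B'_eq: "B' = P' * D' * P'\<^sup>T"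
    using Suc.IH[OF B'] by blast
  define blk :: "real \<Rightarrow> real mat \<Rightarrow> real mat"
    where "blk c M = four_block_mat (mat 1 1 (\<lambda>_. c)) (0\<^sub>m 1 m) (0\<^sub>m m 1) M" for c M
  have B_blk: "B = blk p B'"
    by (rule eq_matI) (use B B' row0 col0 in \<open>auto simp: B'_def blk_def\<close>)
  have blk_mult: "blk a M * blk b N = blk (a * b) (M * N)"
    if "M \<in> carrier_mat m m" "N \<in> carrier_mat m m" for a b :: real and M N
  proof -
    have "mat 1 1 (\<lambda>_. a) * mat 1 1 (\<lambda>_. b) = mat 1 1 (\<lambda>_. a * b)"
      by (rule eq_matI) (auto simp: scalar_prod_def)
    then show ?thesis
      unfolding blk_def using that by (subst mult_four_block_mat[of _ 1 1 _ m _ m _ _ 1 _ m]) auto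
  qed
  have blk_T: "(blk a M)\<^sup>T = blk a M\<^sup>T" if "M \<in> carrier_mat m m" for a :: real and M
  proof -
    have "(mat 1 1 (\<lambda>_. a))\<^sup>T = mat 1 1 (\<lambda>_. a)" by (rule eq_matI) auto
    then show ?thesis unfolding blk_def using that by (subst transpose_four_block_mat[of _ 1 1 _ m _ m]) auto
  qed
  have blk_one: "blk 1 (1\<^sub>m m) = 1\<^sub>m ?n"
    by (rule eq_matI) (auto simp: blk_def)
  define F where "F = blk 1 P'"
  define D where "D = blk p D'"
  have F: "F \<in> carrier_mat ?n ?n" and D: "D \<in> carrier_mat ?n ?n"
    using P' D' by (auto simp: F_def D_def blk_def)
  have FTF: "F\<^sup>T * F = 1\<^sub>m ?n"
    unfolding F_def using P' orth by (simp add: blk_T blk_mult blk_one)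
  have FDF: "F * D * F\<^sup>T = B"
    unfolding F_def D_def B_blk using P' D' B'_eq by (simp add: blk_T blk_mult)
  have [simp]: "F\<^sup>T \<in> carrier_mat ?n ?n" "F\<^sup>T * H \<in> carrier_mat ?n ?n" using F H by auto
  have PT: "(H * F)\<^sup>T = F\<^sup>T * H" using F H by (simp add: transpose_mult)
  have "(H * F)\<^sup>T * (H * F) = F\<^sup>T * ((H * H) * F)"
    unfolding PT using F H(1) by (simp add: assoc_mult_mat[of _ ?n ?n _ ?n _ ?n])
  also have "\<dots> = 1\<^sub>m ?n" using H(3) F FTF by simp
  finally have 1: "(H * F)\<^sup>T * (H * F) = 1\<^sub>m ?n" .
  have "H * F * D * (H * F)\<^sup>T = H * (F * D * F\<^sup>T) * H"
    unfolding PT using F H(1) D by (simp add: assoc_mult_mat[of _ ?n ?n _ ?n _ ?n])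
  also have "\<dots> = (H * H) * A * (H * H)"
    unfolding FDF B_def using A H(1) by (simp add: assoc_mult_mat[of _ ?n ?n _ ?n _ ?n])
  also have "\<dots> = A" using H(3) A by simp
  finally have 2: "A = H * F * D * (H * F)\<^sup>T" by simp
  have "diagonal_mat D"
    using diag D' by (auto simp: diagonal_mat_def D_def blk_def)
  then show ?case using 1 2 F H D by (intro exI[of _ "H * F"] exI[of _ D]) simp
qed


lemma proots_linear_factors:
  fixes bs :: "real list"
  shows "proots (\<Prod>b\<leftarrow>bs. [:- b, 1:]) = mset bs"
proof (induction bs)
  case (Cons b bs)
  have "(\<Prod>b\<leftarrow>bs. [:- b, 1:]) \<noteq> 0" by (auto simp: prod_list_zero_iff)
  then show ?case
    using Cons.IH by (simp only: list.map prod_list.Cons, subst proots_mult) auto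
qed simp

text \<open>
  The spectral theorem for matrices indexed by a finite set. The first equation is Parseval's
  identity, equivalently the orthonormality of the rows of the matrix of eigenvectors; it turns sums
  over the basis into traces.
\<close>

lemma symmetric_kernel_eigenbasis:
  fixes M :: "'a \<Rightarrow> 'a \<Rightarrow> real"
  assumes vs: "distinct vs"
    and sym: "\<And>x y. x \<in> set vs \<Longrightarrow> y \<in> set vs \<Longrightarrow> M x y = M y x"
  obtains u :: "nat \<Rightarrow> 'a \<Rightarrow> real" and a :: "nat \<Rightarrow> real" where
    "\<And>x y. x \<in> set vs \<Longrightarrow> y \<in> set vs \<Longrightarrow> (\<Sum>i<length vs. u i x * u i y) = of_bool (x = y)"
    "\<And>i. i < length vs \<Longrightarrow> (\<Sum>x\<in>set vs. (u i x)\<^sup>2) = 1"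
    "\<And>i x. i < length vs \<Longrightarrow> x \<in> set vs \<Longrightarrow> (\<Sum>y\<in>set vs. M x y * u i y) = a i * u i x"
    "eigenvalues_mset (mat (length vs) (length vs) (\<lambda>(i, j). M (vs ! i) (vs ! j)))
      = image_mset a (mset_set {..<length vs})"
proof -
  define n where "n = length vs"
  define A where "A = mat n n (\<lambda>(i, j). M (vs ! i) (vs ! j))"
  have A: "A \<in> carrier_mat n n" by (simp add: A_def)
  have "A\<^sup>T = A" by (rule eq_matI) (auto simp: A_def n_def intro: sym)
  from real_symmetric_orthogonally_diagonalizable[OF A this] obtain P D
    where P: "P \<in> carrier_mat n n" and D: "D \<in> carrier_mat n n" and orth: "P\<^sup>T * P = 1\<^sub>m n"
      and diag: "diagonal_mat D" and A_eq: "A = P * D * P\<^sup>T" by blast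
  have PT: "P\<^sup>T \<in> carrier_mat n n" using P by simp
  have orth': "P * P\<^sup>T = 1\<^sub>m n" using mat_mult_left_right_inverse[OF PT P orth] .
  define idx where "idx x = the_inv_into {..<n} (\<lambda>k. vs ! k) x" for x
  have bij: "bij_betw (\<lambda>k. vs ! k) {..<n} (set vs)"
    using bij_betw_nth[OF vs] by (simp add: n_def)
  have idx_nth: "idx (vs ! k) = k" if "k < n" for k
    unfolding idx_def using bij that by (intro the_inv_into_f_f) (auto simp: bij_betw_def)
  have reindex: "(\<Sum>x\<in>set vs. h x) = (\<Sum>k<n. h (vs ! k))" for h :: "'a \<Rightarrow> real"
    using sum.reindex_bij_betw[OF bij, of h] by simp
  have idx: "\<exists>k<n. x = vs ! k" if "x \<in> set vs" for x
    using that by (auto simp: in_set_conv_nth n_def)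
  define u where "u i x = P $$ (idx x, i)" for i x
  define a where "a i = D $$ (i, i)" for i
  have AP: "A * P = P * D"
    unfolding A_eq using P D PT orth by (simp add: assoc_mult_mat[of _ n n _ n _ n])
  show thesis
  proof (rule that[of u a])
    fix x y assume "x \<in> set vs" "y \<in> set vs"
    then obtain k l where kl: "k < n" "l < n" "x = vs ! k" "y = vs ! l" using idx by blast
    then have "x = y \<longleftrightarrow> k = l" using idx_nth by metis
    then show "(\<Sum>i<length vs. u i x * u i y) = of_bool (x = y)"
      using arg_cong[OF orth', of "\<lambda>N. N $$ (k, l)"] kl P
      by (simp add: u_def idx_nth scalar_prod_def lessThan_atLeast0 n_def[symmetric])
  next
    fix i assume "i < length vs"
    then show "(\<Sum>x\<in>set vs. (u i x)\<^sup>2) = 1"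
      using arg_cong[OF orth, of "\<lambda>N. N $$ (i, i)"] P unfolding reindex
      by (simp add: u_def idx_nth scalar_prod_def lessThan_atLeast0 n_def[symmetric] power2_eq_square)
  next
    fix i x assume i: "i < length vs" and "x \<in> set vs"
    then obtain k where k: "k < n" "x = vs ! k" using idx by blast
    have "(\<Sum>j<n. P $$ (k, j) * D $$ (j, i)) = (\<Sum>j<n. if j = i then P $$ (k, i) * D $$ (i, i) else 0)"
      using diag D i by (intro sum.cong) (auto simp: diagonal_mat_def n_def)
    then show "(\<Sum>y\<in>set vs. M x y * u i y) = a i * u i x"
      using arg_cong[OF AP, of "\<lambda>N. N $$ (k, i)"] P D A k i unfolding reindex
      by (simp add: u_def a_def A_def idx_nth scalar_prod_def lessThan_atLeast0 n_def[symmetric])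
  next
    have "similar_mat A D"
      unfolding similar_mat_def similar_mat_wit_def Let_def
      using A P D orth orth' A_eq by (intro exI[of _ P] exI[of _ "P\<^sup>T"]) auto
    then have "char_poly A = char_poly D" by (rule char_poly_similar)
    also have "\<dots> = (\<Prod>b\<leftarrow>diag_mat D. [:- b, 1:])"
      using D diag by (intro char_poly_upper_triangular[of _ n])
        (auto simp: diagonal_mat_def upper_triangular_def)
    finally have "proots (char_poly A) = proots (\<Prod>b\<leftarrow>diag_mat D. [:- b, 1:])" by simp
    also have "\<dots> = mset (diag_mat D)"
      using proots_linear_factors .
    also have "\<dots> = image_mset a (mset_set {..<n})"
      using D by (simp add: diag_mat_def a_def[abs_def] lessThan_atLeast0 flip: mset_upt)
    finally show "eigenvalues_mset (mat (length vs) (length vs) (\<lambda>(i, j). M (vs ! i) (vs ! j)))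
      = image_mset a (mset_set {..<length vs})"
      by (simp add: eigenvalues_mset_def A_def n_def)
  qed
qed

section \<open>Quadratic forms on finite sets\<close>

text \<open>
  The signless Laplacian indexed by the vertices themselves, so that sums over the parts of a
  bipartition need no enumeration.
\<close>

definition signless_kernel :: "'a set \<Rightarrow> ('a \<Rightarrow> 'a \<Rightarrow> bool) \<Rightarrow> 'a \<Rightarrow> 'a \<Rightarrow> real" where
  "signless_kernel X R x y = (if x = y then real (card {z \<in> X. R x z}) else 0) + of_bool (R x y)"

text \<open>
  The squared norm of the projection of \<open>h\<close> onto the functions that are supported on \<open>A\<close> and sum to
  zero.
\<close>

definition centered_norm_sq :: "'a set \<Rightarrow> ('a \<Rightarrow> real) \<Rightarrow> real" where
  "centered_norm_sq A h = (\<Sum>x\<in>A. (h x - sum h A / real (card A))\<^sup>2)"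

lemma centered_norm_sq_nonneg: "centered_norm_sq A h \<ge> 0"
  unfolding centered_norm_sq_def by (rule sum_nonneg) simp

lemma centered_norm_sq_altdef:
  assumes "finite A" "A \<noteq> {}"
  shows "centered_norm_sq A h = (\<Sum>x\<in>A. (h x)\<^sup>2) - (sum h A)\<^sup>2 / real (card A)"
proof -
  have c: "real (card A) > 0" using assms by (simp add: card_gt_0_iff)
  have "centered_norm_sq A h = (\<Sum>x\<in>A. (h x)\<^sup>2 - 2 * (sum h A / real (card A)) * h x + (sum h A / real (card A))\<^sup>2)"
    unfolding centered_norm_sq_def by (rule sum.cong) (auto simp: power2_eq_square algebra_simps)
  also have "\<dots> = (\<Sum>x\<in>A. (h x)\<^sup>2) - 2 * (sum h A / real (card A)) * sum h A + real (card A) * (sum h A / real (card A))\<^sup>2"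
    by (simp add: sum.distrib sum_subtractf sum_distrib_left)
  also have "\<dots> = (\<Sum>x\<in>A. (h x)\<^sup>2) - (sum h A)\<^sup>2 / real (card A)"
    using c by (simp add: power2_eq_square field_simps)
  finally show ?thesis .
qed

text \<open>
  With \<open>u\<close> an eigenbasis and \<open>c\<close> the constant \<open>1\<close> or the eigenvalues, \<open>K\<close> is the identity or the
  signless Laplacian, and the right-hand side is a block sum that can be read off the graph.
\<close>

lemma weighted_sum_mult_sums:
  fixes c :: "'i \<Rightarrow> real"
  assumes "\<And>x y. x \<in> A \<Longrightarrow> y \<in> B \<Longrightarrow> (\<Sum>i\<in>I. c i * (u i x * u i y)) = K x y"
  shows "(\<Sum>i\<in>I. c i * (sum (u i) A * sum (u i) B)) = (\<Sum>x\<in>A. \<Sum>y\<in>B. K x y)"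
proof -
  have "(\<Sum>i\<in>I. c i * (sum (u i) A * sum (u i) B)) = (\<Sum>i\<in>I. \<Sum>x\<in>A. \<Sum>y\<in>B. c i * (u i x * u i y))"
    unfolding sum_product by (simp only: sum_distrib_left)
  also have "\<dots> = (\<Sum>x\<in>A. \<Sum>y\<in>B. \<Sum>i\<in>I. c i * (u i x * u i y))"
    by (subst sum.swap, rule sum.cong[OF refl], subst sum.swap, rule refl)
  also have "\<dots> = (\<Sum>x\<in>A. \<Sum>y\<in>B. K x y)" using assms by simp
  finally show ?thesis .
qed

section \<open>Connected bipartite graphs and the eigenspaces of the complete bipartite graph\<close>

locale connected_bipartite =
  fixes U V :: "'a set" and R :: "'a \<Rightarrow> 'a \<Rightarrow> bool"
  assumes finite_parts: "finite U" "finite V" and disjoint: "U \<inter> V = {}"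
    and nonempty: "U \<noteq> {}" "V \<noteq> {}"
    and R_sym: "R x y \<Longrightarrow> R y x"
    and R_cross: "R x y \<Longrightarrow> x \<in> U \<and> y \<in> V \<or> x \<in> V \<and> y \<in> U"
    and R_connected: "x \<in> U \<union> V \<Longrightarrow> y \<in> U \<union> V \<Longrightarrow> R\<^sup>*\<^sup>* x y"
begin

abbreviation "r \<equiv> real (card U)"
abbreviation "s \<equiv> real (card V)"
abbreviation "e x y \<equiv> of_bool (R x y) :: real"
abbreviation "M \<equiv> signless_kernel (U \<union> V) R"

definition edge_count :: real where
  "edge_count = (\<Sum>x\<in>U. \<Sum>y\<in>V. e x y)"

text \<open>
  The two parts play symmetric roles. Facts are proved for \<open>U\<close> and transported to \<open>V\<close> by this lemma.
\<close>

lemma flip: "connected_bipartite V U R"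
proof
  show "x \<in> V \<and> y \<in> U \<or> x \<in> U \<and> y \<in> V" if "R x y" for x y
    using R_cross[OF that] by blast
qed (use finite_parts disjoint nonempty R_sym R_connected in \<open>auto simp: Un_commute\<close>)

lemma edge_count_flip: "connected_bipartite.edge_count V U R = edge_count"
  unfolding edge_count_def connected_bipartite.edge_count_def[OF flip]
  using R_sym by (subst sum.swap) (auto intro!: sum.cong)

lemma part_sizes: "r \<ge> 1" "s \<ge> 1"
  using finite_parts nonempty by (simp_all add: Suc_le_eq card_gt_0_iff)

lemma kernel_sym: "M x y = M y x"
  using R_sym by (auto simp: signless_kernel_def)

lemma kernel_same_part:
  assumes "x \<in> U" "y \<in> U"
  shows "M x y = (if x = y then (\<Sum>z\<in>V. e x z) else 0)"
proof -
  have "{z \<in> U \<union> V. R x z} = V \<inter> {z. R x z}" "\<not> R x y"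
    using assms R_cross disjoint by blast+
  then have "M x y = (if x = y then real (card (V \<inter> {z. R x z})) else 0)"
    unfolding signless_kernel_def by (cases "x = y") (simp_all del: Un_iff)
  also have "real (card (V \<inter> {z. R x z})) = (\<Sum>z\<in>V. e x z)"
    using finite_parts by (simp add: of_bool_def sum.If_cases)
  finally show ?thesis .
qed

lemma kernel_cross: "x \<in> U \<Longrightarrow> y \<in> V \<Longrightarrow> M x y = e x y"
  using disjoint by (auto simp: signless_kernel_def)

lemma sum_kernel_diag: "(\<Sum>x\<in>U. M x x) = edge_count"
  by (simp add: kernel_same_part edge_count_def)

lemma sum_kernel_same_part: "(\<Sum>x\<in>U. \<Sum>y\<in>U. M x y) = edge_count"
  using finite_parts by (simp add: kernel_same_part edge_count_def)

lemma sum_kernel_cross: "(\<Sum>x\<in>U. \<Sum>y\<in>V. M x y) = edge_count"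
  by (simp add: kernel_cross edge_count_def)

lemma kernel_apply:
  assumes "x \<in> U"
  shows "(\<Sum>y\<in>U \<union> V. M x y * h y) = (\<Sum>y\<in>V. e x y * (h x + h y))"
proof -
  have "(\<Sum>y\<in>U \<union> V. M x y * h y) = (\<Sum>y\<in>U. M x y * h y) + (\<Sum>y\<in>V. M x y * h y)"
    using finite_parts disjoint by (simp add: sum.union_disjoint)
  also have "(\<Sum>y\<in>U. M x y * h y) = (\<Sum>y\<in>U. if y = x then (\<Sum>z\<in>V. e x z) * h x else 0)"
    using assms by (intro sum.cong) (auto simp: kernel_same_part)
  also have "\<dots> = (\<Sum>y\<in>V. e x y * h x)" using assms finite_parts by (simp add: sum_distrib_right)
  also have "(\<Sum>y\<in>V. M x y * h y) = (\<Sum>y\<in>V. e x y * h y)"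
    using assms by (simp add: kernel_cross)
  finally show ?thesis by (simp add: sum.distrib algebra_simps)
qed

lemma edge_count_le: "edge_count \<le> r * s"
proof -
  have "edge_count \<le> (\<Sum>x\<in>U. \<Sum>y\<in>V. 1)"
    unfolding edge_count_def by (intro sum_mono) simp
  then show ?thesis by simp
qed

lemma edge_count_eq_iff: "edge_count = r * s \<longleftrightarrow> (\<forall>x\<in>U. \<forall>y\<in>V. R x y)"
proof
  assume eq: "edge_count = r * s"
  have "(\<Sum>x\<in>U. \<Sum>y\<in>V. 1 - e x y) = 0"
    using eq by (simp add: edge_count_def sum_subtractf)
  then have "\<forall>x\<in>U. (\<Sum>y\<in>V. 1 - e x y) = 0"
    using finite_parts by (subst (asm) sum_nonneg_eq_0_iff) (auto intro: sum_nonneg)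
  then have "\<forall>x\<in>U. \<forall>y\<in>V. 1 - e x y = 0"
    using finite_parts by (subst (asm) sum_nonneg_eq_0_iff) auto
  then show "\<forall>x\<in>U. \<forall>y\<in>V. R x y" by (auto simp: of_bool_def split: if_splits)
qed (simp add: edge_count_def)

text \<open>
  The squared norm of the projection of \<open>h\<close> onto the line of the vector \<open>z\<close> that is \<open>s\<close> on \<open>U\<close> and \<open>r\<close>
  on \<open>V\<close>, whose squared norm is \<open>r * s * (r + s)\<close>.
\<close>

definition top_weight :: "('a \<Rightarrow> real) \<Rightarrow> real" where
  "top_weight h = (s * sum h U + r * sum h V)\<^sup>2 / (r * s * (r + s))"

lemma top_weight_nonneg: "top_weight h \<ge> 0"
  unfolding top_weight_def by simp

text \<open>
  The hypothesis says that \<open>h\<close> is orthogonal to the signing vector, the only direction missed by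
  the three projections, so this is Pythagoras' theorem.
\<close>

lemma weights_sum:
  assumes "sum h U = sum h V"
  shows "top_weight h + centered_norm_sq U h + centered_norm_sq V h = (\<Sum>x\<in>U \<union> V. (h x)\<^sup>2)"
proof -
  have pos: "r > 0" "s > 0" using part_sizes by linarith+
  have "top_weight h = (sum h U)\<^sup>2 / r + (sum h U)\<^sup>2 / s"
  proof -
    have "s * sum h U + r * sum h V = (r + s) * sum h U" using assms by (simp add: algebra_simps)
    then have "top_weight h = (r + s)\<^sup>2 * (sum h U)\<^sup>2 / (r * s * (r + s))"
      by (simp add: top_weight_def power_mult_distrib)
    also have "\<dots> = (r + s) * (sum h U)\<^sup>2 / (r * s)" using pos by (simp add: power2_eq_square)
    finally show ?thesis using pos by (simp add: field_simps)
  qed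
  then show ?thesis
    using finite_parts nonempty disjoint assms
    by (simp add: centered_norm_sq_altdef sum.union_disjoint)
qed

text \<open>
  Along every edge \<open>h\<close> changes sign, so by connectedness it is a multiple of the signing vector, which
  is orthogonal to all three eigenspaces.
\<close>

lemma weights_kernel:
  assumes "\<And>x y. x \<in> U \<Longrightarrow> y \<in> V \<Longrightarrow> R x y \<Longrightarrow> h x + h y = 0"
  shows "top_weight h = 0" "centered_norm_sq U h = 0" "centered_norm_sq V h = 0"
proof -
  obtain x0 where x0: "x0 \<in> U" using nonempty by blast
  let ?sg = "\<lambda>x. if x \<in> U then h x else - h x"
  have const: "?sg y = h x0" if "y \<in> U \<union> V" for y
  proof -
    have "R\<^sup>*\<^sup>* x0 y" using R_connected x0 that by blast
    then show ?thesis
    proof induction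
      case (step y z)
      have "?sg z = ?sg y"
        using R_cross[OF step.hyps(2)] R_sym[OF step.hyps(2)] disjoint assms[of y z] assms[of z y]
          step.hyps(2)
        by (auto simp: eq_neg_iff_add_eq_0 neg_eq_iff_add_eq_0 add.commute split: if_splits)
      then show ?case using step.IH by simp
    qed (use x0 in simp)
  qed
  have hU: "h x = h x0" if "x \<in> U" for x using const[of x] that by simp
  have hV: "h y = - h x0" if "y \<in> V" for y
  proof -
    have "y \<notin> U" using that disjoint by blast
    then show ?thesis using const[of y] that by simp
  qed
  have sums: "sum h U = r * h x0" "sum h V = - s * h x0"
    using hU hV by simp_all
  show "top_weight h = 0" by (simp add: top_weight_def sums)
  show "centered_norm_sq U h = 0" "centered_norm_sq V h = 0"
    using part_sizes hU hV by (simp_all add: centered_norm_sq_def sums)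
qed

end

section \<open>Weights of an eigenbasis\<close>

locale signless_eigenbasis = connected_bipartite U V R
  for U V :: "'a set" and R :: "'a \<Rightarrow> 'a \<Rightarrow> bool" +
  fixes I :: "'i set" and u :: "'i \<Rightarrow> 'a \<Rightarrow> real" and a :: "'i \<Rightarrow> real"
  assumes finite_I: "finite I"
    and complete: "x \<in> U \<union> V \<Longrightarrow> y \<in> U \<union> V \<Longrightarrow> (\<Sum>i\<in>I. u i x * u i y) = of_bool (x = y)"
    and normed: "i \<in> I \<Longrightarrow> (\<Sum>x\<in>U \<union> V. (u i x)\<^sup>2) = 1"
    and eigen: "i \<in> I \<Longrightarrow> x \<in> U \<union> V \<Longrightarrow>
      (\<Sum>y\<in>U \<union> V. signless_kernel (U \<union> V) R x y * u i y) = a i * u i x"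
begin

lemma flip_basis: "signless_eigenbasis V U R I u a"
proof -
  interpret flip: connected_bipartite V U R by (rule flip)
  show ?thesis
    using finite_I complete normed eigen
    by unfold_locales (simp_all add: Un_commute)
qed

lemma eigen_U: "i \<in> I \<Longrightarrow> x \<in> U \<Longrightarrow> (\<Sum>y\<in>V. e x y * (u i x + u i y)) = a i * u i x"
  using eigen[of i x] kernel_apply[of x "u i"] by simp

lemma eigen_V: "i \<in> I \<Longrightarrow> y \<in> V \<Longrightarrow> (\<Sum>x\<in>U. e x y * (u i x + u i y)) = a i * u i y"
proof -
  assume "i \<in> I" "y \<in> V"
  then have "(\<Sum>x\<in>U. e y x * (u i y + u i x)) = a i * u i y"
    by (rule signless_eigenbasis.eigen_U[OF flip_basis])
  moreover have "e y x = e x y" for x using R_sym by auto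
  ultimately show ?thesis by (simp add: add.commute)
qed

lemma eigenvalue_quadratic_form:
  assumes "i \<in> I"
  shows "a i = (\<Sum>x\<in>U. \<Sum>y\<in>V. e x y * (u i x + u i y)\<^sup>2)"
proof -
  have "(\<Sum>x\<in>U. \<Sum>y\<in>V. e x y * (u i x + u i y)\<^sup>2)
      = (\<Sum>x\<in>U. \<Sum>y\<in>V. u i x * (e x y * (u i x + u i y)))
      + (\<Sum>x\<in>U. \<Sum>y\<in>V. u i y * (e x y * (u i x + u i y)))"
    unfolding sum.distrib[symmetric]
    by (intro sum.cong refl) (simp add: power2_eq_square algebra_simps)
  also have "(\<Sum>x\<in>U. \<Sum>y\<in>V. u i x * (e x y * (u i x + u i y))) = a i * (\<Sum>x\<in>U. (u i x)\<^sup>2)"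
    unfolding sum_distrib_left[symmetric] using eigen_U[OF assms]
    by (simp add: sum_distrib_left power2_eq_square algebra_simps)
  also have "(\<Sum>x\<in>U. \<Sum>y\<in>V. u i y * (e x y * (u i x + u i y))) = a i * (\<Sum>y\<in>V. (u i y)\<^sup>2)"
    unfolding sum.swap[of _ V U] sum_distrib_left[symmetric] using eigen_V[OF assms]
    by (simp add: sum_distrib_left power2_eq_square algebra_simps)
  finally show ?thesis
    using normed[OF assms] finite_parts disjoint
    by (simp add: sum.union_disjoint distrib_left[symmetric])
qed

lemma eigenvalue_nonneg: "i \<in> I \<Longrightarrow> a i \<ge> 0"
  by (simp add: eigenvalue_quadratic_form sum_nonneg)

lemma eigenvalue_zero_weights:
  assumes "i \<in> I" "a i = 0"
  shows "top_weight (u i) = 0" "centered_norm_sq U (u i) = 0" "centered_norm_sq V (u i) = 0"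
proof -
  have "(\<Sum>x\<in>U. \<Sum>y\<in>V. e x y * (u i x + u i y)\<^sup>2) = 0"
    using eigenvalue_quadratic_form[OF assms(1)] assms(2) by simp
  then have "\<forall>x\<in>U. (\<Sum>y\<in>V. e x y * (u i x + u i y)\<^sup>2) = 0"
    using finite_parts by (subst (asm) sum_nonneg_eq_0_iff) (auto intro: sum_nonneg)
  then have "\<forall>x\<in>U. \<forall>y\<in>V. e x y * (u i x + u i y)\<^sup>2 = 0"
    using finite_parts by (subst (asm) sum_nonneg_eq_0_iff) auto
  then have *: "u i x + u i y = 0" if "x \<in> U" "y \<in> V" "R x y" for x y
    using that by (simp add: power2_eq_square)
  show "top_weight (u i) = 0" "centered_norm_sq U (u i) = 0" "centered_norm_sq V (u i) = 0"
    by (rule weights_kernel; fact *)+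
qed

text \<open>
  Eigenvectors of a non-zero eigenvalue are orthogonal to the signing vector, which lies in the
  kernel: both sides multiplied by \<open>a i\<close> are the same sum over the edges.
\<close>

lemma part_sums_eq:
  assumes "i \<in> I" "a i \<noteq> 0"
  shows "sum (u i) U = sum (u i) V"
proof -
  have "a i * sum (u i) U = (\<Sum>x\<in>U. \<Sum>y\<in>V. e x y * (u i x + u i y))"
    using eigen_U[OF assms(1)] by (simp add: sum_distrib_left)
  also have "\<dots> = a i * sum (u i) V"
    unfolding sum.swap[of _ V U] using eigen_V[OF assms(1)] by (simp add: sum_distrib_left)
  finally show ?thesis using assms(2) by simp
qed

lemma weights_sum_one:
  assumes "i \<in> I" "a i \<noteq> 0"
  shows "top_weight (u i) + centered_norm_sq U (u i) + centered_norm_sq V (u i) = 1"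
  using weights_sum[OF part_sums_eq[OF assms]] normed[OF assms(1)] by simp

lemma spectral_expansion:
  assumes "x \<in> U \<union> V" "y \<in> U \<union> V"
  shows "(\<Sum>i\<in>I. a i * (u i x * u i y)) = M x y"
proof -
  have "(\<Sum>i\<in>I. a i * (u i x * u i y)) = (\<Sum>i\<in>I. (\<Sum>z\<in>U \<union> V. M x z * u i z) * u i y)"
    using eigen assms by (simp add: mult.assoc)
  also have "\<dots> = (\<Sum>z\<in>U \<union> V. M x z * (\<Sum>i\<in>I. u i z * u i y))"
    by (simp add: sum_distrib_left sum_distrib_right mult.assoc sum.swap[of _ "U \<union> V" I])
  also have "\<dots> = (\<Sum>z\<in>U \<union> V. if z = y then M x y else 0)"
    using assms by (intro sum.cong refl) (simp add: complete)
  also have "\<dots> = M x y" using assms finite_parts by simp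
  finally show ?thesis .
qed

lemma sum_centered_norm_sq:
  assumes K: "\<And>x y. x \<in> U \<Longrightarrow> y \<in> U \<Longrightarrow> (\<Sum>i\<in>I. c i * (u i x * u i y)) = K x y"
  shows "(\<Sum>i\<in>I. centered_norm_sq U (u i) * c i) = (\<Sum>x\<in>U. K x x) - (\<Sum>x\<in>U. \<Sum>y\<in>U. K x y) / r"
proof -
  have "(\<Sum>i\<in>I. centered_norm_sq U (u i) * c i)
      = (\<Sum>i\<in>I. \<Sum>x\<in>U. c i * (u i x * u i x)) - (\<Sum>i\<in>I. c i * (sum (u i) U * sum (u i) U)) / r"
    using finite_parts nonempty
    by (simp add: centered_norm_sq_altdef sum_divide_distrib sum_subtractf[symmetric] sum_distrib_left
        power2_eq_square algebra_simps)
  also have "(\<Sum>i\<in>I. c i * (sum (u i) U * sum (u i) U)) = (\<Sum>x\<in>U. \<Sum>y\<in>U. K x y)"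
    using K by (rule weighted_sum_mult_sums)
  also have "(\<Sum>i\<in>I. \<Sum>x\<in>U. c i * (u i x * u i x)) = (\<Sum>x\<in>U. K x x)"
    by (subst sum.swap) (simp add: K)
  finally show ?thesis .
qed

lemma sum_top_weight:
  assumes K: "\<And>x y. x \<in> U \<union> V \<Longrightarrow> y \<in> U \<union> V \<Longrightarrow> (\<Sum>i\<in>I. c i * (u i x * u i y)) = K x y"
  shows "(\<Sum>i\<in>I. top_weight (u i) * c i)
    = (s\<^sup>2 * (\<Sum>x\<in>U. \<Sum>y\<in>U. K x y) + 2 * r * s * (\<Sum>x\<in>U. \<Sum>y\<in>V. K x y)
       + r\<^sup>2 * (\<Sum>x\<in>V. \<Sum>y\<in>V. K x y)) / (r * s * (r + s))"
proof -
  have "top_weight (u i) * c i = (s\<^sup>2 * (c i * (sum (u i) U * sum (u i) U))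
       + 2 * r * s * (c i * (sum (u i) U * sum (u i) V))
       + r\<^sup>2 * (c i * (sum (u i) V * sum (u i) V))) / (r * s * (r + s))" for i
  proof -
    have "(s * x + r * y)\<^sup>2 * c i = s\<^sup>2 * (c i * (x * x)) + 2 * r * s * (c i * (x * y)) + r\<^sup>2 * (c i * (y * y))"
      for x y by (simp add: power2_eq_square algebra_simps)
    then show ?thesis by (simp add: top_weight_def)
  qed
  then have "(\<Sum>i\<in>I. top_weight (u i) * c i)
      = (s\<^sup>2 * (\<Sum>i\<in>I. c i * (sum (u i) U * sum (u i) U))
       + 2 * r * s * (\<Sum>i\<in>I. c i * (sum (u i) U * sum (u i) V))
       + r\<^sup>2 * (\<Sum>i\<in>I. c i * (sum (u i) V * sum (u i) V))) / (r * s * (r + s))"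
    by (simp only: sum_distrib_left[symmetric] sum_divide_distrib[symmetric] sum.distrib)
  also have "(\<Sum>i\<in>I. c i * (sum (u i) U * sum (u i) U)) = (\<Sum>x\<in>U. \<Sum>y\<in>U. K x y)"
    by (rule weighted_sum_mult_sums) (simp add: K)
  also have "(\<Sum>i\<in>I. c i * (sum (u i) U * sum (u i) V)) = (\<Sum>x\<in>U. \<Sum>y\<in>V. K x y)"
    by (rule weighted_sum_mult_sums) (simp add: K)
  also have "(\<Sum>i\<in>I. c i * (sum (u i) V * sum (u i) V)) = (\<Sum>x\<in>V. \<Sum>y\<in>V. K x y)"
    by (rule weighted_sum_mult_sums) (simp add: K)
  finally show ?thesis .
qed

text \<open>
  The traces of the projection onto the functions on \<open>U\<close> of sum zero, and of its product with the
  signless Laplacian. The first is the dimension of that space; in the second only degrees occur,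
  because no edge joins two vertices of \<open>U\<close>.
\<close>

lemma total_centered_norm_sq:
  "(\<Sum>i\<in>I. centered_norm_sq U (u i)) = r - 1"
  "(\<Sum>i\<in>I. centered_norm_sq U (u i) * a i) = edge_count * (1 - 1 / r)"
proof -
  have "(\<Sum>i\<in>I. centered_norm_sq U (u i) * 1)
      = (\<Sum>x\<in>U. of_bool (x = x)) - (\<Sum>x\<in>U. \<Sum>y\<in>U. of_bool (x = y)) / r"
    by (rule sum_centered_norm_sq) (simp add: complete)
  also have "\<dots> = r - 1" using nonempty finite_parts by (simp add: of_bool_def)
  finally show "(\<Sum>i\<in>I. centered_norm_sq U (u i)) = r - 1" by simp
  have "(\<Sum>i\<in>I. centered_norm_sq U (u i) * a i) = (\<Sum>x\<in>U. M x x) - (\<Sum>x\<in>U. \<Sum>y\<in>U. M x y) / r"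
    by (rule sum_centered_norm_sq) (simp add: spectral_expansion)
  then show "(\<Sum>i\<in>I. centered_norm_sq U (u i) * a i) = edge_count * (1 - 1 / r)"
    by (simp add: sum_kernel_diag sum_kernel_same_part algebra_simps)
qed

lemma total_top_weight:
  "(\<Sum>i\<in>I. top_weight (u i)) = 1"
  "(\<Sum>i\<in>I. top_weight (u i) * a i) = edge_count * ((r + s) / (r * s))"
proof -
  have pos: "r > 0" "s > 0" using part_sizes by linarith+
  have cross0: "(\<Sum>x\<in>U. \<Sum>y\<in>V. of_bool (x = y) :: real) = 0"
    using disjoint by (intro sum.neutral ballI) auto
  have "(\<Sum>i\<in>I. top_weight (u i) * 1)
    = (s\<^sup>2 * (\<Sum>x\<in>U. \<Sum>y\<in>U. of_bool (x = y)) + 2 * r * s * (\<Sum>x\<in>U. \<Sum>y\<in>V. of_bool (x = y))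
       + r\<^sup>2 * (\<Sum>x\<in>V. \<Sum>y\<in>V. of_bool (x = y))) / (r * s * (r + s))"
    by (rule sum_top_weight) (simp add: complete)
  also have "\<dots> = (s\<^sup>2 * r + r\<^sup>2 * s) / (r * s * (r + s))"
    using finite_parts by (simp only: cross0) (simp add: of_bool_def)
  also have "s\<^sup>2 * r + r\<^sup>2 * s = r * s * (r + s)" by (simp add: power2_eq_square algebra_simps)
  also have "r * s * (r + s) / (r * s * (r + s)) = 1"
    using pos by (metis add_pos_pos divide_self_if less_irrefl mult_pos_pos)
  finally show "(\<Sum>i\<in>I. top_weight (u i)) = 1" by simp
  have VV: "(\<Sum>x\<in>V. \<Sum>y\<in>V. M x y) = edge_count"
    using connected_bipartite.sum_kernel_same_part[OF flip] edge_count_flip by (simp add: Un_commute)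
  have "(\<Sum>i\<in>I. top_weight (u i) * a i)
    = (s\<^sup>2 * (\<Sum>x\<in>U. \<Sum>y\<in>U. M x y) + 2 * r * s * (\<Sum>x\<in>U. \<Sum>y\<in>V. M x y)
       + r\<^sup>2 * (\<Sum>x\<in>V. \<Sum>y\<in>V. M x y)) / (r * s * (r + s))"
    by (rule sum_top_weight) (simp add: spectral_expansion)
  also have "\<dots> = edge_count * (r + s)\<^sup>2 / (r * s * (r + s))"
    by (simp add: VV sum_kernel_same_part sum_kernel_cross power2_eq_square algebra_simps)
  also have "\<dots> = edge_count * ((r + s) / (r * s))"
    using pos by (simp add: power2_eq_square)
  finally show "(\<Sum>i\<in>I. top_weight (u i) * a i) = edge_count * ((r + s) / (r * s))" .
qed

text \<open>
  The weights vanish on the kernel, so a sum over the non-zero eigenvalues may be replaced by a sum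
  over the whole basis, where it becomes a trace. The kernel cannot be treated by tangents, since
  \<open>x powr \<alpha>\<close> has none at \<open>0\<close> when \<open>\<alpha> < 1\<close>.
\<close>

lemma sum_over_nonzero:
  "(\<Sum>i | i \<in> I \<and> a i \<noteq> 0. top_weight (u i) * p i + centered_norm_sq U (u i) * q i
      + centered_norm_sq V (u i) * t i)
   = (\<Sum>i\<in>I. top_weight (u i) * p i) + (\<Sum>i\<in>I. centered_norm_sq U (u i) * q i)
      + (\<Sum>i\<in>I. centered_norm_sq V (u i) * t i)"
  unfolding sum.distrib[symmetric] using finite_I
  by (rule sum.mono_neutral_left) (auto simp: eigenvalue_zero_weights)

text \<open>
  Klein's trace inequality against the complete bipartite graph. Each \<open>f (a i)\<close> is split by the weights
  and bounded by the tangent at the eigenvalue belonging to that weight. The slope terms differ from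
  those of the complete graph only through the number of missing edges.
\<close>

lemma spectral_sum_le:
  assumes tangent: "\<And>x y. x > 0 \<Longrightarrow> y > 0 \<Longrightarrow> f x \<le> f y + f' y * (x - y)"
  shows "(\<Sum>i | i \<in> I \<and> a i \<noteq> 0. f (a i)) \<le> f (r + s) + (r - 1) * f s + (s - 1) * f r
    - (r * s - edge_count) * (f' (r + s) * ((r + s) / (r * s)) + f' s * (1 - 1 / r) + f' r * (1 - 1 / s))"
proof -
  have pos: "r > 0" "s > 0" using part_sizes by linarith+
  note totals = total_top_weight total_centered_norm_sq
    signless_eigenbasis.total_centered_norm_sq[OF flip_basis, unfolded edge_count_flip]
  let ?t = "\<lambda>y x. f y + f' y * (x - y)"
  have lin: "(\<Sum>i\<in>I. w i * ?t y (a i)) = (f y - f' y * y) * (\<Sum>i\<in>I. w i) + f' y * (\<Sum>i\<in>I. w i * a i)"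
    for w y
  proof -
    have "w i * ?t y (a i) = (f y - f' y * y) * w i + f' y * (w i * a i)" for i
      by (simp add: algebra_simps)
    then show ?thesis by (simp only: sum.distrib sum_distrib_left)
  qed
  have "(\<Sum>i | i \<in> I \<and> a i \<noteq> 0. f (a i))
    \<le> (\<Sum>i | i \<in> I \<and> a i \<noteq> 0. top_weight (u i) * ?t (r + s) (a i)
        + centered_norm_sq U (u i) * ?t s (a i) + centered_norm_sq V (u i) * ?t r (a i))"
  proof (rule sum_mono)
    fix i assume "i \<in> {i. i \<in> I \<and> a i \<noteq> 0}"
    then have i: "i \<in> I" "a i \<noteq> 0" by auto
    then have "a i > 0" using eigenvalue_nonneg by (simp add: order_less_le)
    then have "f (a i) \<le> ?t y (a i)" if "y > 0" for y using tangent that by simp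
    then have "top_weight (u i) * f (a i) + centered_norm_sq U (u i) * f (a i) + centered_norm_sq V (u i) * f (a i)
      \<le> top_weight (u i) * ?t (r + s) (a i)
        + centered_norm_sq U (u i) * ?t s (a i) + centered_norm_sq V (u i) * ?t r (a i)"
      using pos top_weight_nonneg centered_norm_sq_nonneg
      by (intro add_mono mult_left_mono) auto
    moreover have "top_weight (u i) * f (a i) + centered_norm_sq U (u i) * f (a i)
        + centered_norm_sq V (u i) * f (a i) = f (a i)"
      using weights_sum_one[OF i] by (simp only: distrib_right[symmetric] mult_1)
    ultimately show "f (a i) \<le> top_weight (u i) * ?t (r + s) (a i)
        + centered_norm_sq U (u i) * ?t s (a i) + centered_norm_sq V (u i) * ?t r (a i)"
      by (simp only:)
  qed
  also have "\<dots> = (\<Sum>i\<in>I. top_weight (u i) * ?t (r + s) (a i))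
      + (\<Sum>i\<in>I. centered_norm_sq U (u i) * ?t s (a i)) + (\<Sum>i\<in>I. centered_norm_sq V (u i) * ?t r (a i))"
    by (rule sum_over_nonzero)
  also have "\<dots> = f (r + s) + (r - 1) * f s + (s - 1) * f r
    - (r * s - edge_count) * (f' (r + s) * ((r + s) / (r * s)) + f' s * (1 - 1 / r) + f' r * (1 - 1 / s))"
  proof -
    \<comment> \<open>The conditions say that with \<open>r * s\<close> edges the \<open>a\<close>-weighted totals would be multiplicity times
      eigenvalue, so the slope terms would cancel.\<close>
    have regroup: "(f (r + s) - A * (r + s)) * 1 + A * (edge_count * k)
        + ((f s - B * s) * (r - 1) + B * (edge_count * p))
        + ((f r - C * r) * (s - 1) + C * (edge_count * q))
      = f (r + s) + (r - 1) * f s + (s - 1) * f r - (r * s - edge_count) * (A * k + B * p + C * q)"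
      if "r + s = r * s * k" "s * (r - 1) = r * s * p" "r * (s - 1) = r * s * q" for A B C k p q
    proof -
      have "A * (r + s) = A * (r * s * k)" "B * s * (r - 1) = B * (r * s * p)"
        "C * r * (s - 1) = C * (r * s * q)"
        using that by (simp_all only: mult.assoc)
      then show ?thesis by (simp only: left_diff_distrib) (simp add: algebra_simps)
    qed
    have 1: "r + s = r * s * ((r + s) / (r * s))" using pos by simp
    have 2: "s * (r - 1) = r * s * (1 - 1 / r)" "r * (s - 1) = r * s * (1 - 1 / s)"
      using pos by (simp_all add: right_diff_distrib)
    show ?thesis
      unfolding lin totals using regroup[OF 1 2, of "f' (r + s)" "f' s" "f' r"] .
  qed
  finally show ?thesis .
qed

lemma complete_top_eigenvalue:
  assumes "\<forall>x\<in>U. \<forall>y\<in>V. R x y" "i \<in> I" "a i \<noteq> 0" "top_weight (u i) \<noteq> 0"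
  shows "a i = r + s"
proof -
  note T = part_sums_eq[OF assms(2,3)]
  have "a i * sum (u i) U = (\<Sum>x\<in>U. \<Sum>y\<in>V. e x y * (u i x + u i y))"
    using eigen_U[OF assms(2)] by (simp add: sum_distrib_left)
  also have "\<dots> = (\<Sum>x\<in>U. \<Sum>y\<in>V. u i x + u i y)" using assms(1) by simp
  also have "\<dots> = s * sum (u i) U + r * sum (u i) V"
    by (simp add: sum.distrib sum_distrib_left)
  also have "\<dots> = (r + s) * sum (u i) U" using T by (simp add: algebra_simps)
  finally have "a i = r + s \<or> sum (u i) U = 0" by auto
  moreover have "sum (u i) U \<noteq> 0"
    using assms(4) T by (auto simp: top_weight_def)
  ultimately show ?thesis by simp
qed

text \<open>
  On \<open>U\<close> the eigenvalue equation reads \<open>(s - a i) * u i x = - sum (u i) U\<close>. Subtracting its average over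
  \<open>U\<close> shows that \<open>s - a i\<close> annihilates the deviation of \<open>u i\<close> from its mean.
\<close>

lemma complete_part_eigenvalue:
  assumes "\<forall>x\<in>U. \<forall>y\<in>V. R x y" "i \<in> I" "a i \<noteq> 0" "centered_norm_sq U (u i) \<noteq> 0"
  shows "a i = s"
proof -
  note T = part_sums_eq[OF assms(2,3)]
  have pw: "(s - a i) * u i x = - sum (u i) U" if "x \<in> U" for x
  proof -
    have "a i * u i x = (\<Sum>y\<in>V. u i x + u i y)"
      using eigen_U[OF assms(2) that] assms(1) that by simp
    then show ?thesis using T by (simp add: sum.distrib algebra_simps)
  qed
  have "(\<Sum>x\<in>U. (s - a i) * u i x) = (\<Sum>x\<in>U. - sum (u i) U)"
    using pw by (intro sum.cong) auto
  then have mean: "(s - a i) * (sum (u i) U / r) = - sum (u i) U"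
    using part_sizes by (simp add: sum_distrib_left[symmetric])
  have "\<exists>x\<in>U. u i x - sum (u i) U / r \<noteq> 0"
  proof (rule ccontr)
    assume none: "\<not> ?thesis"
    have "centered_norm_sq U (u i) = 0"
      unfolding centered_norm_sq_def
    proof (rule sum.neutral, rule ballI)
      fix x assume "x \<in> U"
      with none show "(u i x - sum (u i) U / r)\<^sup>2 = 0" by (metis power_zero_numeral)
    qed
    then show False using assms(4) by simp
  qed
  then obtain x where x: "x \<in> U" "u i x - sum (u i) U / r \<noteq> 0" by blast
  have "(s - a i) * (u i x - sum (u i) U / r) = 0"
    unfolding right_diff_distrib pw[OF x(1)] mean by simp
  then have "s - a i = 0" using x(2) by (metis mult_eq_0_iff)
  then show ?thesis by simp
qed

text \<open>
  For the complete bipartite graph a non-zero weight determines the eigenvalue, so splitting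
  \<open>f (a i)\<close> by the weights involves no loss, whatever \<open>f\<close> is.
\<close>

lemma spectral_sum_complete:
  fixes f :: "real \<Rightarrow> real"
  assumes all: "\<forall>x\<in>U. \<forall>y\<in>V. R x y"
  shows "(\<Sum>i | i \<in> I \<and> a i \<noteq> 0. f (a i)) = f (r + s) + (r - 1) * f s + (s - 1) * f r"
proof -
  have all': "\<forall>x\<in>V. \<forall>y\<in>U. R x y" using all R_sym by blast
  have "(\<Sum>i | i \<in> I \<and> a i \<noteq> 0. f (a i))
    = (\<Sum>i | i \<in> I \<and> a i \<noteq> 0. top_weight (u i) * f (r + s)
        + centered_norm_sq U (u i) * f s + centered_norm_sq V (u i) * f r)"
  proof (rule sum.cong[OF refl])
    fix i assume "i \<in> {i. i \<in> I \<and> a i \<noteq> 0}"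
    then have i: "i \<in> I" "a i \<noteq> 0" by auto
    have "top_weight (u i) * f (r + s) = top_weight (u i) * f (a i)"
      using complete_top_eigenvalue[OF all i] by fastforce
    moreover have "centered_norm_sq U (u i) * f s = centered_norm_sq U (u i) * f (a i)"
      using complete_part_eigenvalue[OF all i] by fastforce
    moreover have "centered_norm_sq V (u i) * f r = centered_norm_sq V (u i) * f (a i)"
      using signless_eigenbasis.complete_part_eigenvalue[OF flip_basis all' i] by fastforce
    ultimately show "f (a i) = top_weight (u i) * f (r + s)
        + centered_norm_sq U (u i) * f s + centered_norm_sq V (u i) * f r"
      using weights_sum_one[OF i] by (simp only: distrib_right[symmetric] mult_1)
  qed
  also have "\<dots> = (\<Sum>i\<in>I. top_weight (u i) * f (r + s))
      + (\<Sum>i\<in>I. centered_norm_sq U (u i) * f s) + (\<Sum>i\<in>I. centered_norm_sq V (u i) * f r)"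
    by (rule sum_over_nonzero)
  also have "\<dots> = f (r + s) + (r - 1) * f s + (s - 1) * f r"
    unfolding sum_distrib_right[symmetric] total_top_weight total_centered_norm_sq
      signless_eigenbasis.total_centered_norm_sq[OF flip_basis] by simp
  finally show ?thesis .
qed

end

section \<open>Concavity\<close>

text \<open>
  The factor \<open>sgn \<alpha>\<close> turns the convex decreasing powers with \<open>\<alpha> < 0\<close> into concave increasing functions,
  so that both signs of \<open>\<alpha>\<close> are treated at once. The derivative \<open>\<bar>\<alpha>\<bar> * t powr (\<alpha> - 1)\<close> is antitone, and
  the mean value theorem gives the bound.
\<close>

lemma signed_powr_tangent:
  fixes \<alpha> x y :: real
  assumes "\<alpha> \<le> 1" "x > 0" "y > 0"
  shows "sgn \<alpha> * x powr \<alpha> \<le> sgn \<alpha> * y powr \<alpha> + \<bar>\<alpha>\<bar> * y powr (\<alpha> - 1) * (x - y)"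
proof -
  let ?f = "\<lambda>t. sgn \<alpha> * t powr \<alpha>" and ?f' = "\<lambda>t. \<bar>\<alpha>\<bar> * t powr (\<alpha> - 1)"
  have deriv: "DERIV ?f t :> ?f' t" if "t > 0" for t
    using that by (auto intro!: derivative_eq_intros simp: abs_sgn)
  have anti: "?f' t \<le> ?f' u" if "0 < u" "u \<le> t" for t u
    using that assms(1) by (intro mult_left_mono powr_mono2') auto
  consider "x < y" | "x = y" | "y < x" by linarith
  then show ?thesis
  proof cases
    case 1
    obtain z where z: "x < z" "z < y" "?f y - ?f x = (y - x) * ?f' z"
      using MVT2[OF 1, of ?f ?f'] deriv assms(2) by auto
    have "(y - x) * ?f' z \<ge> (y - x) * ?f' y"
      using z assms(2) 1 by (intro mult_left_mono anti) auto
    then show ?thesis using z(3) by (simp add: algebra_simps)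
  next
    case 3
    obtain z where z: "y < z" "z < x" "?f x - ?f y = (x - y) * ?f' z"
      using MVT2[OF 3, of ?f ?f'] deriv assms(3) by auto
    have "(x - y) * ?f' z \<le> (x - y) * ?f' y"
      using z assms(3) 3 by (intro mult_left_mono anti) auto
    then show ?thesis using z(3) by (simp add: algebra_simps)
  qed simp
qed

text \<open>
  The value of \<open>S_alpha\<close> on the complete bipartite graph with parts of sizes \<open>r\<close> and \<open>s\<close>.
\<close>

definition bipartite_power_sum :: "real \<Rightarrow> real \<Rightarrow> real \<Rightarrow> real" where
  "bipartite_power_sum \<alpha> r s = (r + s) powr \<alpha> + (r - 1) * s powr \<alpha> + (s - 1) * r powr \<alpha>"

lemma bipartite_power_sum_commute: "bipartite_power_sum \<alpha> r s = bipartite_power_sum \<alpha> s r"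
  by (simp add: bipartite_power_sum_def add.commute)

text \<open>
  With \<open>n = r + s\<close> and \<open>g x = sgn \<alpha> * (x - 1) * (n - x) powr \<alpha>\<close> the claim is \<open>g s - g q < g p - g r\<close>. The
  intervals from \<open>r\<close> to \<open>p\<close> and from \<open>q\<close> to \<open>s\<close> have equal length, the second lies to the right of the
  first, and the derivative of \<open>g\<close> is strictly decreasing.
\<close>

lemma bipartite_power_sum_less_balanced:
  fixes \<alpha> r s p q :: real
  assumes "\<alpha> \<le> 1" "\<alpha> \<noteq> 0" "1 \<le> r" "r < p" "p \<le> q" "r + s = p + q"
  shows "sgn \<alpha> * bipartite_power_sum \<alpha> r s < sgn \<alpha> * bipartite_power_sum \<alpha> p q"
proof -
  define n where "n = r + s"
  let ?g = "\<lambda>x. sgn \<alpha> * ((x - 1) * (n - x) powr \<alpha>)"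
  let ?g' = "\<lambda>x. sgn \<alpha> * (n - x) powr \<alpha> - \<bar>\<alpha>\<bar> * ((x - 1) * (n - x) powr (\<alpha> - 1))"
  have sgn: "sgn \<alpha> * \<alpha> = \<bar>\<alpha>\<bar>" by (simp add: abs_sgn mult.commute)
  have deriv: "DERIV ?g x :> ?g' x" if "x < n" for x
  proof -
    have "DERIV ?g x :> sgn \<alpha> * ((n - x) powr \<alpha> - (x - 1) * (\<alpha> * (n - x) powr (\<alpha> - 1)))"
      using that by (auto intro!: derivative_eq_intros)
    also have "sgn \<alpha> * ((n - x) powr \<alpha> - (x - 1) * (\<alpha> * (n - x) powr (\<alpha> - 1)))
      = sgn \<alpha> * (n - x) powr \<alpha> - (sgn \<alpha> * \<alpha>) * ((x - 1) * (n - x) powr (\<alpha> - 1))"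
      by (simp only: right_diff_distrib mult_ac)
    finally show ?thesis by (simp only: sgn)
  qed
  have anti: "?g' y < ?g' x" if "1 \<le> x" "x < y" "y < n" for x y
  proof -
    have "sgn \<alpha> * (n - y) powr \<alpha> < sgn \<alpha> * (n - x) powr \<alpha>"
    proof (cases "\<alpha> > 0")
      case True
      then show ?thesis using that by (simp add: powr_less_mono2)
    next
      case False
      then show ?thesis using that assms(2) by (simp add: powr_less_mono2_neg)
    qed
    moreover have "(x - 1) * (n - x) powr (\<alpha> - 1) \<le> (y - 1) * (n - y) powr (\<alpha> - 1)"
      using that assms(1) by (intro mult_mono powr_mono2') auto
    then have "\<bar>\<alpha>\<bar> * ((x - 1) * (n - x) powr (\<alpha> - 1)) \<le> \<bar>\<alpha>\<bar> * ((y - 1) * (n - y) powr (\<alpha> - 1))"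
      by (intro mult_left_mono) auto
    ultimately show ?thesis by linarith
  qed
  have qs: "q < s" "s < n" "p - r = s - q" using assms by (auto simp: n_def)
  obtain z where z: "r < z" "z < p" "?g p - ?g r = (p - r) * ?g' z"
    using MVT2[OF \<open>r < p\<close>, of ?g ?g'] deriv qs assms by auto
  obtain w where w: "q < w" "w < s" "?g s - ?g q = (s - q) * ?g' w"
    using MVT2[OF \<open>q < s\<close>, of ?g ?g'] deriv qs by auto
  have "?g' w < ?g' z" by (rule anti) (use z w assms qs in auto)
  then have "(s - q) * ?g' w < (p - r) * ?g' z" using qs by simp
  then have "?g s + ?g r < ?g p + ?g q" using z(3) w(3) by linarith
  moreover have "n - s = r" "n - r = s" "n - p = q" "n - q = p" using assms by (auto simp: n_def)
  ultimately show ?thesis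
    using assms(6) by (simp add: bipartite_power_sum_def algebra_simps)
qed

lemma bipartite_power_sum_le_balanced:
  fixes \<alpha> :: real and r s n :: nat
  assumes \<alpha>: "\<alpha> \<le> 1" "\<alpha> \<noteq> 0" and "1 \<le> r" "1 \<le> s" "r + s = n"
  shows "sgn \<alpha> * bipartite_power_sum \<alpha> (real r) (real s)
      < sgn \<alpha> * bipartite_power_sum \<alpha> (real (n div 2)) (real (n - n div 2))
    \<or> {r, s} = {n div 2, n - n div 2} \<and> bipartite_power_sum \<alpha> (real r) (real s)
      = bipartite_power_sum \<alpha> (real (n div 2)) (real (n - n div 2))"
proof -
  have less: "sgn \<alpha> * bipartite_power_sum \<alpha> (real r') (real s')
      < sgn \<alpha> * bipartite_power_sum \<alpha> (real (n div 2)) (real (n - n div 2))"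
    if "1 \<le> r'" "r' < n div 2" "r' + s' = n" for r' s' :: nat
  proof (rule bipartite_power_sum_less_balanced[OF \<alpha>])
    show "1 \<le> real r'" "real r' < real (n div 2)" "real (n div 2) \<le> real (n - n div 2)"
      using that by simp_all
    have "real (r' + s') = real (n div 2 + (n - n div 2))" using that(3) by simp
    then show "real r' + real s' = real (n div 2) + real (n - n div 2)" by (simp only: of_nat_add)
  qed
  consider "r < n div 2" | "s < n div 2" | "r = n div 2" "s = n - n div 2" | "s = n div 2" "r = n - n div 2"
    using \<open>r + s = n\<close> by linarith
  then show ?thesis
  proof cases
    case 1
    then show ?thesis using less[of r s] assms by blast
  next
    case 2
    then have "sgn \<alpha> * bipartite_power_sum \<alpha> (real s) (real r)
      < sgn \<alpha> * bipartite_power_sum \<alpha> (real (n div 2)) (real (n - n div 2))"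
      using assms by (intro less) simp_all
    then show ?thesis by (simp only: bipartite_power_sum_commute[of \<alpha> "real s"] simp_thms)
  next
    case 3
    then show ?thesis by blast
  next
    case 4
    then show ?thesis
      using bipartite_power_sum_commute[of \<alpha> "real r" "real s"] by (simp only: insert_commute) simp
  qed
qed

section \<open>The signless Laplacian of a connected bipartite graph\<close>

lemma (in graph) out_degree_eq_card_neighbours:
  "out_degree G x = card {z \<in> verts G. x \<rightarrow>\<^bsub>G\<^esub> z}"
proof -
  have "head G ` out_arcs G x = {z \<in> verts G. x \<rightarrow>\<^bsub>G\<^esub> z}"
    by (auto simp: arcs_ends_conv)
  moreover have "inj_on (head G) (out_arcs G x)"
    by (rule inj_onI) (auto intro: no_multi_arcs simp: arc_to_ends_def)
  ultimately show ?thesis unfolding out_degree_def by (metis card_image)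
qed

lemma (in graph) signless_laplacian_eq_kernel:
  assumes "distinct vs"
  shows "signless_laplacian G vs = mat (length vs) (length vs)
    (\<lambda>(i, j). signless_kernel (verts G) (\<lambda>x y. x \<rightarrow>\<^bsub>G\<^esub> y) (vs ! i) (vs ! j))"
  using assms
  by (intro eq_matI) (auto simp: signless_laplacian_def degree_matrix_def adjacency_matrix_def
      signless_kernel_def out_degree_eq_card_neighbours nth_eq_iff_index_eq)

text \<open>
  Both parts are non-empty since a connected graph with two vertices has an arc.
\<close>

lemma (in graph) connected_bipartite_parts:
  assumes "connected G" "card (verts G) \<ge> 2"
    and "verts G = U \<union> V" "U \<inter> V = {}" "arcs_ends G \<subseteq> U \<times> V \<union> V \<times> U"
  shows "connected_bipartite U V (\<lambda>x y. x \<rightarrow>\<^bsub>G\<^esub> y)"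
proof -
  have reach: "(\<lambda>x y. x \<rightarrow>\<^bsub>G\<^esub> y)\<^sup>*\<^sup>* x y" if "x \<in> verts G" "y \<in> verts G" for x y
  proof -
    have "x \<rightarrow>\<^sup>*\<^bsub>mk_symmetric G\<^esub> y"
      using assms(1) that by (auto simp: connected_def strongly_connected_def)
    then have "x \<rightarrow>\<^sup>* y" using reachable_mk_symmetric_eq[OF sym_arcs] by simp
    then have "(x, y) \<in> (arcs_ends G)\<^sup>*" by (rule reachable_rtranclI)
    then show ?thesis by (simp add: rtrancl_def)
  qed
  have "arcs_ends G \<noteq> {}"
  proof
    assume none: "arcs_ends G = {}"
    have "x = y" if "x \<in> verts G" "y \<in> verts G" for x y
      using reach[OF that] by (auto simp: none elim: rtranclp.cases)
    then have "card (verts G) \<le> 1" using card_le_Suc0_iff_eq[OF finite_verts] by auto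
    then show False using assms(2) by simp
  qed
  moreover have "finite U" "finite V" using finite_verts assms(3) by auto
  ultimately show ?thesis
    using assms(3-5) reach graph_symmetric by unfold_locales auto
qed

text \<open>
  The extremal statement for fixed sizes of the parts: the positive constant \<open>C\<close> multiplies the number
  of missing edges, so equality leaves no edge missing.
\<close>

lemma (in graph) S_alpha_bipartite:
  assumes "connected G" "card (verts G) \<ge> 2"
    and parts: "verts G = U \<union> V" "U \<inter> V = {}" "arcs_ends G \<subseteq> U \<times> V \<union> V \<times> U"
    and vs: "distinct vs" "set vs = verts G" and \<alpha>: "\<alpha> \<le> 1" "\<alpha> \<noteq> 0"
  defines "B \<equiv> sgn \<alpha> * bipartite_power_sum \<alpha> (real (card U)) (real (card V))"
  shows "sgn \<alpha> * S_alpha \<alpha> G vs \<le> B"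
    and "sgn \<alpha> * S_alpha \<alpha> G vs = B \<longleftrightarrow> arcs_ends G = U \<times> V \<union> V \<times> U"
    and "1 \<le> card U" "1 \<le> card V"
proof -
  interpret P: connected_bipartite U V "\<lambda>x y. x \<rightarrow>\<^bsub>G\<^esub> y"
    using connected_bipartite_parts assms by blast
  obtain u a where
    basis: "\<And>x y. x \<in> set vs \<Longrightarrow> y \<in> set vs \<Longrightarrow> (\<Sum>i<length vs. u i x * u i y) = of_bool (x = y)"
      "\<And>i. i < length vs \<Longrightarrow> (\<Sum>x\<in>set vs. (u i x)\<^sup>2) = 1"
      "\<And>i x. i < length vs \<Longrightarrow> x \<in> set vs \<Longrightarrow>
        (\<Sum>y\<in>set vs. signless_kernel (U \<union> V) (\<lambda>x y. x \<rightarrow>\<^bsub>G\<^esub> y) x y * u i y) = a i * u i x"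
      and spec: "eigenvalues_mset (mat (length vs) (length vs)
        (\<lambda>(i, j). signless_kernel (U \<union> V) (\<lambda>x y. x \<rightarrow>\<^bsub>G\<^esub> y) (vs ! i) (vs ! j)))
        = image_mset a (mset_set {..<length vs})"
    using symmetric_kernel_eigenbasis[OF vs(1), of "signless_kernel (U \<union> V) (\<lambda>x y. x \<rightarrow>\<^bsub>G\<^esub> y)"]
      P.kernel_sym by blast
  interpret E: signless_eigenbasis U V "\<lambda>x y. x \<rightarrow>\<^bsub>G\<^esub> y" "{..<length vs}" u a
    using basis unfolding vs(2) parts(1) by unfold_locales auto
  let ?f = "\<lambda>x. sgn \<alpha> * x powr \<alpha>" and ?f' = "\<lambda>x. \<bar>\<alpha>\<bar> * x powr (\<alpha> - 1)"
  have "eigenvalues_mset (signless_laplacian G vs) = image_mset a (mset_set {..<length vs})"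
    using spec by (simp add: signless_laplacian_eq_kernel[OF vs(1)] parts(1))
  then have "S_alpha \<alpha> G vs = (\<Sum>i | i \<in> {..<length vs} \<and> a i \<noteq> 0. a i powr \<alpha>)"
    unfolding S_alpha_def
    by (simp add: filter_mset_image_mset sum_unfold_sum_mset multiset.map_comp o_def)
  then have S: "sgn \<alpha> * S_alpha \<alpha> G vs = (\<Sum>i | i \<in> {..<length vs} \<and> a i \<noteq> 0. ?f (a i))"
    by (simp only: sum_distrib_left)
  have B: "B = ?f (P.r + P.s) + (P.r - 1) * ?f P.s + (P.s - 1) * ?f P.r"
    by (simp add: B_def bipartite_power_sum_def algebra_simps)
  define C where "C = ?f' (P.r + P.s) * ((P.r + P.s) / (P.r * P.s))
    + ?f' P.s * (1 - 1 / P.r) + ?f' P.r * (1 - 1 / P.s)"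
  have le: "sgn \<alpha> * S_alpha \<alpha> G vs \<le> B - (P.r * P.s - P.edge_count) * C"
    unfolding S B C_def using signed_powr_tangent[OF \<alpha>(1)] by (rule E.spectral_sum_le)
  have "C > 0"
    unfolding C_def using P.part_sizes \<alpha>(2)
    by (intro add_pos_nonneg mult_pos_pos mult_nonneg_nonneg) (auto simp: field_simps)
  have gap: "(P.r * P.s - P.edge_count) * C \<ge> 0"
    using P.edge_count_le \<open>C > 0\<close> by simp
  show "sgn \<alpha> * S_alpha \<alpha> G vs \<le> B" using le gap by linarith
  have all_iff: "(\<forall>x\<in>U. \<forall>y\<in>V. x \<rightarrow>\<^bsub>G\<^esub> y) \<longleftrightarrow> arcs_ends G = U \<times> V \<union> V \<times> U"
    using parts(3) P.R_sym by blast
  show "sgn \<alpha> * S_alpha \<alpha> G vs = B \<longleftrightarrow> arcs_ends G = U \<times> V \<union> V \<times> U"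
  proof
    assume "sgn \<alpha> * S_alpha \<alpha> G vs = B"
    then have "(P.r * P.s - P.edge_count) * C = 0" using le gap by linarith
    then have "P.edge_count = P.r * P.s" using \<open>C > 0\<close> by simp
    then show "arcs_ends G = U \<times> V \<union> V \<times> U"
      using P.edge_count_eq_iff all_iff by blast
  next
    assume "arcs_ends G = U \<times> V \<union> V \<times> U"
    then have "\<forall>x\<in>U. \<forall>y\<in>V. x \<rightarrow>\<^bsub>G\<^esub> y" using all_iff by blast
    then show "sgn \<alpha> * S_alpha \<alpha> G vs = B" unfolding S B by (rule E.spectral_sum_complete)
  qed
  show "1 \<le> card U" "1 \<le> card V" using P.part_sizes by simp_all
qed

section \<open>The balanced complete bipartite graph is extremal\<close>

theorem theorem3p2:
  fixes G :: "('a, 'b) pre_digraph" and vs :: "'a list" and n :: nat and \<alpha> :: real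
  assumes "n \<ge> 2"
    and "Digraph.graph G" and "card (verts G) = n"
    and "Digraph_Component.connected G" and "bipartite G"
    and "distinct vs" and "set vs = verts G"
    and "\<alpha> \<le> 1" and "\<alpha> \<noteq> 0"
  defines "bound \<equiv> real n powr \<alpha>
      + (real_of_int \<lfloor>real n / 2\<rfloor> - 1) * real_of_int \<lceil>real n / 2\<rceil> powr \<alpha>
      + (real_of_int \<lceil>real n / 2\<rceil> - 1) * real_of_int \<lfloor>real n / 2\<rfloor> powr \<alpha>"
  shows "(\<alpha> < 0 \<longrightarrow>
            S_alpha \<alpha> G vs \<ge> bound \<and>
            (S_alpha \<alpha> G vs = bound \<longleftrightarrow>
               complete_bipartite_digraph (nat \<lfloor>real n / 2\<rfloor>) (nat \<lceil>real n / 2\<rceil>) G)) \<and>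
         (0 < \<alpha> \<and> \<alpha> \<le> 1 \<longrightarrow>
            S_alpha \<alpha> G vs \<le> bound \<and>
            (S_alpha \<alpha> G vs = bound \<longleftrightarrow>
               complete_bipartite_digraph (nat \<lfloor>real n / 2\<rfloor>) (nat \<lceil>real n / 2\<rceil>) G))"
proof -
  interpret graph G by fact
  define p q where "p = n div 2" and "q = n - n div 2"
  have floor: "\<lfloor>real n / 2\<rfloor> = int p"
    unfolding p_def using floor_divide_of_nat_eq[of n 2] by simp
  have ceil: "\<lceil>real n / 2\<rceil> = int q"
  proof (rule ceiling_unique)
    have "n \<le> 2 * q" "2 * q \<le> n + 1" by (simp_all add: q_def)
    then show "real_of_int (int q) - 1 < real n / 2" "real n / 2 \<le> real_of_int (int q)"
      by linarith+
  qed
  have pq: "p + q = n" by (simp add: p_def q_def)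
  have bound: "bound = bipartite_power_sum \<alpha> (real p) (real q)"
    unfolding bound_def floor ceil bipartite_power_sum_def using pq by (simp flip: of_nat_add)
  note spectral = S_alpha_bipartite[OF \<open>connected G\<close> _ _ _ _ \<open>distinct vs\<close> \<open>set vs = verts G\<close>
      \<open>\<alpha> \<le> 1\<close> \<open>\<alpha> \<noteq> 0\<close>, unfolded \<open>card (verts G) = n\<close>, OF \<open>n \<ge> 2\<close>]
  obtain U V where UV: "verts G = U \<union> V" "U \<inter> V = {}" "arcs_ends G \<subseteq> U \<times> V \<union> V \<times> U"
    using \<open>bipartite G\<close> unfolding bipartite_def by blast
  have "finite U" "finite V" using finite_verts UV(1) by auto
  then have card_UV: "card U + card V = n"
    using UV \<open>card (verts G) = n\<close> by (simp add: card_Un_disjoint)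
  note balanced = bipartite_power_sum_le_balanced[OF \<open>\<alpha> \<le> 1\<close> \<open>\<alpha> \<noteq> 0\<close> spectral(3)[OF UV] spectral(4)[OF UV]
      card_UV, folded p_def q_def bound]
  have le: "sgn \<alpha> * S_alpha \<alpha> G vs \<le> sgn \<alpha> * bound"
    using spectral(1)[OF UV] balanced by auto
  have eq: "sgn \<alpha> * S_alpha \<alpha> G vs = sgn \<alpha> * bound \<longleftrightarrow> complete_bipartite_digraph p q G"
  proof
    assume "sgn \<alpha> * S_alpha \<alpha> G vs = sgn \<alpha> * bound"
    then have "{card U, card V} = {p, q}"
      and "sgn \<alpha> * S_alpha \<alpha> G vs = sgn \<alpha> * bipartite_power_sum \<alpha> (real (card U)) (real (card V))"
      using spectral(1)[OF UV] balanced by auto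
    then have "arcs_ends G = U \<times> V \<union> V \<times> U" "{card U, card V} = {p, q}"
      using spectral(2)[OF UV] by blast+
    then show "complete_bipartite_digraph p q G"
      using UV \<open>Digraph.graph G\<close> unfolding complete_bipartite_digraph_def doubleton_eq_iff
      by (metis Int_commute Un_commute)
  next
    assume "complete_bipartite_digraph p q G"
    then obtain U' V' where UV': "verts G = U' \<union> V'" "U' \<inter> V' = {}"
      "arcs_ends G = U' \<times> V' \<union> V' \<times> U'" and "card U' = p" "card V' = q"
      unfolding complete_bipartite_digraph_def by blast
    then show "sgn \<alpha> * S_alpha \<alpha> G vs = sgn \<alpha> * bound"
      using spectral(2)[OF UV'(1,2)] by (simp add: bound)
  qed
  show ?thesis
    unfolding floor ceil nat_int using le eq by (auto simp: sgn_if)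
qed

end
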